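(* We have $h(\alpha) \geq 5$ for every real $\alpha \geq 2$ and $h(\alpha) \geq 7$ for every $\alpha \in \left[\frac{1+\sqrt{5}}{2},2\right)$. For every $\alpha \in \left(1,\frac{1+\sqrt{5}}{2}\right)$, we have \[h(\alpha) \geq \left\lfloor\sqrt{\frac{1}{\alpha - 1}}\right\rfloor.\]
   Context: $\mathbb{N}_0=\{0,1,2,\dots\}$. For a real number $\alpha>1$, the exponential lattice is $L(\alpha)=\{\alpha^n \colon n \in \mathbb{N}_0\}^2=\{(\alpha^i,\alpha^j)\colon i,j\in\mathbb{N}_0\}\subseteq\mathbb{R}^2$. For a discrete set $S\subseteq\mathbb{R}^2$, a convex polygon $P$ with all vertices in $S$ is empty in $S$ if $P$ (including its boundary, in particular the interiors of its edges) contains no points of $S$ other than its vertices. $h(S)$ denotes the maximum number of vertices of an empty polygon in $S$, with $h(S)=\infty$ if there are empty polygons in $S$ with arbitrarily many vertices. $h(\alpha)$ abbreviates $h(L(\alpha))$. *)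

theory Defs
  imports "HOL-Analysis.Analysis" "HOL-Library.Extended_Nat"
begin

definition exp_lattice :: "real \<Rightarrow> (real \<times> real) set" where
  "exp_lattice \<alpha> = {(\<alpha> ^ i, \<alpha> ^ j) | i j :: nat. True}"

(* Nonempty interior excludes the empty set, points and segments. *)
definition convex_polygon :: "(real \<times> real) set \<Rightarrow> bool" where
  "convex_polygon P \<longleftrightarrow> polytope P \<and> interior P \<noteq> {}"

definition polygon_vertices :: "(real \<times> real) set \<Rightarrow> (real \<times> real) set" where
  "polygon_vertices P = {v. v extreme_point_of P}"

definition empty_polygon_in :: "(real \<times> real) set \<Rightarrow> (real \<times> real) set \<Rightarrow> bool" where
  "empty_polygon_in S P \<longleftrightarrow>
     convex_polygon P \<and> polygon_vertices P \<subseteq> S \<and> P \<inter> S \<subseteq> polygon_vertices P"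

(* In enat, Sup of a nonempty set is its maximum if the set is bounded and \<infinity> otherwise.
   If S has no empty polygon at all, the value is Sup {} = 0. *)
definition max_empty_polygon :: "(real \<times> real) set \<Rightarrow> enat" where
  "max_empty_polygon S = Sup {enat (card (polygon_vertices P)) | P. empty_polygon_in S P}"

definition h :: "real \<Rightarrow> enat" where
  "h \<alpha> = max_empty_polygon (exp_lattice \<alpha>)"

end

theory Submission
  imports Defs
begin

text \<open>Each polygon is the hull of a finite set \<open>V\<close> of lattice points such that every lattice
  point, whether a vertex or not, strictly minimises some linear functional over the remaining
  points of \<open>V\<close>. This one condition says both that all points of \<open>V\<close> are vertices and that no
  further lattice point lies in the hull.

  With exponents in place of points, the pentagon is \<open>(0,2), (1,1), (2,0), (2,1), (1,2)\<close>, and the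
  heptagon is \<open>(0,n+2), (n,n+1), (n+1,n), (n+2,0), (n+2,1), (n+1,n+1), (1,n+2)\<close>. The latter is
  convex at \<open>(n+1,n+1)\<close> as soon as \<open>\<alpha> ^ n * (2 - \<alpha>) > 1\<close>, and on the opposite side since
  \<open>\<alpha>\<^sup>2 \<ge> \<alpha> + 1\<close>. For small \<open>\<alpha>\<close> the vertices are the lattice points on the branch
  \<open>x * y = \<alpha> ^ k\<close>; lattice points above it satisfy \<open>x * y \<ge> \<alpha> ^ (k+1)\<close>, and they lie beyond
  the chord \<open>x + y = 1 + \<alpha> ^ k\<close> if \<open>4 * \<alpha> ^ (k+1) > (1 + \<alpha> ^ k)\<^sup>2\<close>.\<close>

section \<open>Empty polygons from linear separators\<close>

text \<open>The hypothesis \<open>ncol\<close> keeps \<open>V\<close> off every line. This gives the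
  hull nonempty interior, since a convex set with empty interior lies in a hyperplane.\<close>

lemma max_empty_polygon_ge:
  fixes V :: "(real \<times> real) set"
  assumes "finite V" and "V \<subseteq> S"
    and sep: "\<And>s. s \<in> S \<Longrightarrow> \<exists>a. \<forall>v\<in>V - {s}. a \<bullet> s < a \<bullet> v"
    and ncol: "\<And>a b. a \<noteq> 0 \<Longrightarrow> \<exists>v\<in>V. a \<bullet> v \<noteq> b"
  shows "max_empty_polygon S \<ge> enat (card V)"
proof -
  let ?P = "convex hull V"
  have out: "s \<notin> convex hull (V - {s})" if s: "s \<in> S" for s
  proof -
    obtain a where a: "\<forall>v\<in>V - {s}. a \<bullet> s < a \<bullet> v" using sep[OF s] by blast
    have "convex hull (V - {s}) \<subseteq> {x. a \<bullet> s < a \<bullet> x}"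
      by (rule hull_minimal) (use a convex_halfspace_gt[of "a \<bullet> s" a] in auto)
    then show ?thesis by auto
  qed
  have vert: "polygon_vertices ?P = V"
    unfolding polygon_vertices_def
    using extreme_point_of_convex_hull_convex_independent[OF finite_imp_compact[OF \<open>finite V\<close>]]
      out \<open>V \<subseteq> S\<close> by blast
  have "interior ?P \<noteq> {}"
  proof
    assume "interior ?P = {}"
    then obtain a b where "a \<noteq> 0" "?P \<subseteq> {x. a \<bullet> x = b}"
      using empty_interior_subset_hyperplane[OF convex_convex_hull] by metis
    with ncol[of a b] show False using hull_subset[of V convex] by blast
  qed
  \<comment> \<open>For \<open>s\<close> outside \<open>V\<close> the set \<open>V - {s}\<close> is
    \<open>V\<close> itself, so \<open>out\<close> excludes \<open>s\<close> from the whole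
    hull.\<close>
  moreover have "?P \<inter> S \<subseteq> V"
  proof
    fix s assume "s \<in> ?P \<inter> S"
    then show "s \<in> V" using out[of s] by (cases "s \<in> V") auto
  qed
  ultimately have "empty_polygon_in S ?P"
    using \<open>finite V\<close> \<open>V \<subseteq> S\<close> vert
    by (auto simp: empty_polygon_in_def convex_polygon_def polytope_def)
  then show ?thesis
    unfolding max_empty_polygon_def by (intro Sup_upper CollectI exI[of _ ?P]) (simp add: vert)
qed

text \<open>Coordinate form of the criterion: one nonzero cross product of \<open>q - p\<close> and
  \<open>r - p\<close> replaces the condition on all lines.\<close>

lemma h_ge:
  assumes "finite V" and "V \<subseteq> exp_lattice \<alpha>"
    and sep: "\<And>i j. \<exists>a c. \<forall>v\<in>V - {(\<alpha> ^ i, \<alpha> ^ j)}. a * \<alpha> ^ i + c * \<alpha> ^ j < a * fst v + c * snd v"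
    and ncol: "p \<in> V" "q \<in> V" "r \<in> V"
      "(fst q - fst p) * (snd r - snd p) \<noteq> (snd q - snd p) * (fst r - fst p)"
  shows "h \<alpha> \<ge> enat (card V)"
  unfolding h_def
proof (rule max_empty_polygon_ge[OF assms(1,2)])
  fix s assume "s \<in> exp_lattice \<alpha>"
  then obtain i j where s: "s = (\<alpha> ^ i, \<alpha> ^ j)" by (auto simp: exp_lattice_def)
  obtain a c where "\<forall>v\<in>V - {s}. a * \<alpha> ^ i + c * \<alpha> ^ j < a * fst v + c * snd v"
    using sep s by blast
  then show "\<exists>a. \<forall>v\<in>V - {s}. a \<bullet> s < a \<bullet> v"
    by (intro exI[of _ "(a, c)"]) (force simp: s)
next
  fix a :: "real \<times> real" and b assume "a \<noteq> 0"
  show "\<exists>v\<in>V. a \<bullet> v \<noteq> b"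
  proof (rule ccontr)
    assume "\<not> ?thesis"
    then have eq: "a \<bullet> p = b" "a \<bullet> q = b" "a \<bullet> r = b" using ncol by blast+
    obtain x y where a: "a = (x, y)" by (cases a)
    define D where "D = (fst q - fst p) * (snd r - snd p) - (snd q - snd p) * (fst r - fst p)"
    have lin: "x * (fst q - fst p) + y * (snd q - snd p) = 0"
      "x * (fst r - fst p) + y * (snd r - snd p) = 0"
      using eq by (auto simp: a inner_prod_def algebra_simps)
    \<comment> \<open>Cramer's rule: eliminating one unknown from the two equations
      \<open>lin\<close> shows that \<open>D\<close> annihilates both components of the normal
      vector \<open>a\<close>.\<close>
    have "x * D = (x * (fst q - fst p) + y * (snd q - snd p)) * (snd r - snd p)
        - (x * (fst r - fst p) + y * (snd r - snd p)) * (snd q - snd p)"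
      by (simp add: D_def algebra_simps)
    moreover have "y * D = (x * (fst r - fst p) + y * (snd r - snd p)) * (fst q - fst p)
        - (x * (fst q - fst p) + y * (snd q - snd p)) * (fst r - fst p)"
      by (simp add: D_def algebra_simps)
    ultimately have "x * D = 0" "y * D = 0" using lin by simp_all
    moreover have "D \<noteq> 0" using ncol by (simp add: D_def)
    ultimately show False using \<open>a \<noteq> 0\<close> by (simp add: a zero_prod_def)
  qed
qed

lemma mem_exp_lattice [intro]: "(\<alpha> ^ i, \<alpha> ^ j) \<in> exp_lattice \<alpha>"
  by (auto simp: exp_lattice_def)

lemma separatorI:
  fixes V :: "(real \<times> real) set"
  assumes "\<forall>v\<in>V - {(x, y)}. a * x + c * y < a * fst v + c * snd v"
  shows "\<exists>a c. \<forall>v\<in>V - {(x, y)}. a * x + c * y < a * fst v + c * snd v"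
  using assms by blast

text \<open>The pentagon and the heptagon are symmetric about the diagonal, so their case analyses
  can be restricted to exponents with \<open>j \<le> i\<close>.\<close>

lemma separator_swap:
  fixes V :: "(real \<times> real) set"
  assumes "prod.swap ` V = V"
    and "\<exists>a c. \<forall>v\<in>V - {(x, y)}. a * x + c * y < a * fst v + c * snd v"
  shows "\<exists>a c. \<forall>v\<in>V - {(y, x)}. a * y + c * x < a * fst v + c * snd v"
proof -
  obtain a c where ac: "\<forall>v\<in>V - {(x, y)}. a * x + c * y < a * fst v + c * snd v"
    using assms(2) by blast
  have "c * y + a * x < c * fst v + a * snd v" if "v \<in> V - {(y, x)}" for v
  proof -
    have "prod.swap v \<in> V - {(x, y)}" using that imageI[of v V prod.swap] unfolding assms(1) by (cases v) auto
    then have "a * x + c * y < a * snd v + c * fst v" using ac by (metis fst_swap snd_swap)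
    then show ?thesis by linarith
  qed
  then show ?thesis by blast
qed

section \<open>The pentagon\<close>

lemma h_ge_5:
  assumes "\<alpha> > 1"
  shows "h \<alpha> \<ge> 5"
proof -
  define V where "V = {(1, \<alpha>\<^sup>2), (\<alpha>, \<alpha>), (\<alpha>\<^sup>2, 1), (\<alpha>\<^sup>2, \<alpha>), (\<alpha>, \<alpha>\<^sup>2)}"
  \<comment> \<open>The last inequality is (\<alpha> - 1)^2 > 0; it puts (\<alpha>, \<alpha>)
    strictly below the chord from (1, \<alpha>^2) to (\<alpha>^2, 1).\<close>
  have sq: "\<alpha> < \<alpha>\<^sup>2" "1 < \<alpha>\<^sup>2" "2 * \<alpha> < \<alpha>\<^sup>2 + 1"
    using assms power_strict_increasing[of 1 2 \<alpha>] zero_less_power[of "\<alpha> - 1" 2]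
    by (simp_all add: power2_diff)
  have swap: "prod.swap ` V = V" unfolding V_def by auto
  have main: "\<exists>a c. \<forall>v\<in>V - {(\<alpha> ^ i, \<alpha> ^ j)}. a * \<alpha> ^ i + c * \<alpha> ^ j < a * fst v + c * snd v"
    if ji: "j \<le> i" for i j
  proof -
    consider "i > 2" | "i = 2" "j = 2" | "i = 2" "j = 1" | "i = 2" "j = 0" | "i = 1" "j = 1"
      | "i = 1" "j = 0" | "i = 0" "j = 0" using ji by linarith
    then show ?thesis
    proof cases
      case 1
      then have "\<alpha>\<^sup>2 < \<alpha> ^ i" using assms by (intro power_strict_increasing)
      with sq have "\<alpha>\<^sup>2 < \<alpha> ^ i" "\<alpha> < \<alpha> ^ i" by linarith+
      then show ?thesis
        by (intro separatorI[where a = "-1" and c = 0]) (use sq assms in \<open>auto simp: V_def\<close>)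
    next
      case 2
      then show ?thesis
        by (intro separatorI[where a = "-1" and c = "-1"]) (use sq assms in \<open>auto simp: V_def\<close>)
    next
      case 3
      then show ?thesis
        by (intro separatorI[where a = "-2" and c = "-1"]) (use sq assms in \<open>auto simp: V_def\<close>)
    next
      case 4
      then show ?thesis
        by (intro separatorI[where a = 0 and c = 1]) (use sq assms in \<open>auto simp: V_def\<close>)
    next
      \<comment> \<open>Among the vertices x + y is least at (\<alpha>, \<alpha>); at (\<alpha>, 1)
        and (1, 1) it is smaller still, so one functional serves the last three cases.\<close>
      case 5
      then show ?thesis
        by (intro separatorI[where a = 1 and c = 1]) (use sq assms in \<open>auto simp: V_def\<close>)
    next
      case 6
      then show ?thesis
        by (intro separatorI[where a = 1 and c = 1]) (use sq assms in \<open>auto simp: V_def\<close>)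
    next
      case 7
      then show ?thesis
        by (intro separatorI[where a = 1 and c = 1]) (use sq assms in \<open>auto simp: V_def\<close>)
    qed
  qed
  have "V \<subseteq> exp_lattice \<alpha>"
    using mem_exp_lattice[of \<alpha> 0 2] mem_exp_lattice[of \<alpha> 1 1] mem_exp_lattice[of \<alpha> 2 0]
      mem_exp_lattice[of \<alpha> 2 1] mem_exp_lattice[of \<alpha> 1 2] by (simp add: V_def)
  then have "enat (card V) \<le> h \<alpha>"
  proof (rule h_ge[rotated])
    show "finite V" by (simp add: V_def)
    show "\<exists>a c. \<forall>v\<in>V - {(\<alpha> ^ i, \<alpha> ^ j)}. a * \<alpha> ^ i + c * \<alpha> ^ j < a * fst v + c * snd v" for i j
      using main[of j i] separator_swap[OF swap main[of i j]] by (cases "j \<le> i") auto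
    show "(\<alpha>\<^sup>2, \<alpha>) \<in> V" "(\<alpha>, \<alpha>) \<in> V" "(\<alpha>, \<alpha>\<^sup>2) \<in> V" by (simp_all add: V_def)
    show "(fst (\<alpha>, \<alpha>) - fst (\<alpha>\<^sup>2, \<alpha>)) * (snd (\<alpha>, \<alpha>\<^sup>2) - snd (\<alpha>\<^sup>2, \<alpha>)) \<noteq>
      (snd (\<alpha>, \<alpha>) - snd (\<alpha>\<^sup>2, \<alpha>)) * (fst (\<alpha>, \<alpha>\<^sup>2) - fst (\<alpha>\<^sup>2, \<alpha>))"
      using sq by simp
  qed
  moreover have "card V = 5" using sq assms by (auto simp: V_def)
  ultimately show ?thesis by (simp add: numeral_eq_enat)
qed

section \<open>Vertices on a hyperbola\<close>

lemma h_ge_hyperbola: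
  assumes "\<alpha> > 1" and "k \<ge> 2" and bound: "(1 + \<alpha> ^ k)\<^sup>2 < 4 * \<alpha> ^ (k + 1)"
  shows "h \<alpha> \<ge> enat (k + 1)"
proof -
  define V where "V = (\<lambda>l. (\<alpha> ^ l, \<alpha> ^ (k - l))) ` {..k}"
  have inj: "inj_on (\<lambda>l. (\<alpha> ^ l, \<alpha> ^ (k - l))) {..k}"
    using assms(1) by (auto simp: inj_on_def)
  have sep: "\<exists>a c. \<forall>v\<in>V - {(\<alpha> ^ i, \<alpha> ^ j)}. a * \<alpha> ^ i + c * \<alpha> ^ j < a * fst v + c * snd v" for i j
  proof (cases "i + j \<le> k")
    case True
    \<comment> \<open>The functional is the gradient of x * y at the lattice point. AM-GM bounds its
      value P + Q at a vertex below by 2 * sqrt (P * Q). Strictness comes from the exponents if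
      \<open>i + j < k\<close>, and from P and Q being different if
      \<open>i + j = k\<close>.\<close>
    have "\<alpha> ^ j * \<alpha> ^ i + \<alpha> ^ i * \<alpha> ^ j < \<alpha> ^ j * \<alpha> ^ l + \<alpha> ^ i * \<alpha> ^ (k - l)"
      if l: "l \<le> k" "(\<alpha> ^ l, \<alpha> ^ (k - l)) \<noteq> (\<alpha> ^ i, \<alpha> ^ j)" for l
    proof -
      define P Q where "P = \<alpha> ^ j * \<alpha> ^ l" and "Q = \<alpha> ^ i * \<alpha> ^ (k - l)"
      have PQ: "P * Q = \<alpha> ^ (i + j + k)"
        using l(1) by (simp add: P_def Q_def add_ac flip: power_add)
      have "(2 * \<alpha> ^ (i + j))\<^sup>2 < (P + Q)\<^sup>2"
      proof (cases "i + j < k")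
        case True
        then have "(\<alpha> ^ (i + j))\<^sup>2 < P * Q"
          unfolding PQ power_even_eq[symmetric] using assms(1) by (intro power_strict_increasing) auto
        moreover have "(P + Q)\<^sup>2 = (P - Q)\<^sup>2 + 4 * (P * Q)" by (simp add: power2_eq_square algebra_simps)
        ultimately show ?thesis
          by (simp add: power_mult_distrib add_strict_increasing2)
      next
        case False
        with True \<open>i + j \<le> k\<close> have k: "k = i + j" by simp
        have "j + l \<noteq> i + (k - l)"
        proof
          assume "j + l = i + (k - l)"
          then have "l = i" using l(1) k by linarith
          with l(2) k show False by simp
        qed
        then have "P \<noteq> Q" using assms(1) by (simp add: P_def Q_def flip: power_add)
        then have "0 < (P - Q)\<^sup>2" by simp
        moreover have "(P + Q)\<^sup>2 = (P - Q)\<^sup>2 + 4 * (P * Q)" by (simp add: power2_eq_square algebra_simps)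
        moreover have "P * Q = (\<alpha> ^ (i + j))\<^sup>2" unfolding PQ k by (simp add: power2_eq_square power_add)
        ultimately show ?thesis
          by (simp add: power_mult_distrib)
      qed
      then have "2 * \<alpha> ^ (i + j) < P + Q"
        by (rule power_less_imp_less_base) (use assms(1) in \<open>simp add: P_def Q_def\<close>)
      then show ?thesis by (simp add: P_def Q_def power_add)
    qed
    then show ?thesis
      by (intro separatorI[where a = "\<alpha> ^ j" and c = "\<alpha> ^ i"]) (unfold V_def, force)
  next
    case False
    \<comment> \<open>No vertex lies above the chord joining the two end vertices, whereas AM-GM and
      \<open>bound\<close> put every lattice point with \<open>i + j > k\<close> strictly above
      it.\<close>
    have chord: "\<alpha> ^ l + \<alpha> ^ (k - l) \<le> 1 + \<alpha> ^ k" if "l \<le> k" for l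
    proof -
      have "0 \<le> (\<alpha> ^ l - 1) * (\<alpha> ^ (k - l) - 1)"
        using assms(1) by (intro mult_nonneg_nonneg) auto
      also have "\<dots> = 1 + \<alpha> ^ k - (\<alpha> ^ l + \<alpha> ^ (k - l))"
        using that by (simp add: algebra_simps flip: power_add)
      finally show ?thesis by simp
    qed
    have "\<alpha> ^ (k + 1) \<le> \<alpha> ^ (i + j)"
      using False assms(1) by (intro power_increasing) auto
    then have "(1 + \<alpha> ^ k)\<^sup>2 < 4 * (\<alpha> ^ i * \<alpha> ^ j)"
      using bound by (simp add: power_add)
    also have "\<dots> \<le> (\<alpha> ^ i + \<alpha> ^ j)\<^sup>2"
      using zero_le_power2[of "\<alpha> ^ i - \<alpha> ^ j"]
      by (simp add: power2_sum power2_diff del: zero_le_power2)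
    finally have "1 + \<alpha> ^ k < \<alpha> ^ i + \<alpha> ^ j"
      by (rule power_less_imp_less_base) (use assms(1) in simp)
    then show ?thesis
      by (intro separatorI[where a = "-1" and c = "-1"]) (use chord in \<open>fastforce simp: V_def\<close>)
  qed
  have "enat (card V) \<le> h \<alpha>"
  proof (rule h_ge[OF _ _ sep])
    show "finite V" by (simp add: V_def)
    show "V \<subseteq> exp_lattice \<alpha>" by (auto simp: V_def)
    show "(\<alpha> ^ 0, \<alpha> ^ (k - 0)) \<in> V" "(\<alpha> ^ 1, \<alpha> ^ (k - 1)) \<in> V" "(\<alpha> ^ 2, \<alpha> ^ (k - 2)) \<in> V"
      unfolding V_def using assms(2) by (intro image_eqI[OF refl]; simp)+
    obtain m where k: "k = m + 2" using assms(2) by (metis add.commute le_Suc_ex)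
    have "(\<alpha> - 1) * (\<alpha> ^ m - \<alpha> ^ (m + 2)) - (\<alpha> ^ (m + 1) - \<alpha> ^ (m + 2)) * (\<alpha>\<^sup>2 - 1)
        = \<alpha> ^ m * ((\<alpha> - 1) * (\<alpha> - 1) * (\<alpha>\<^sup>2 - 1))"
      by (simp add: power_add power2_eq_square algebra_simps)
    also have "\<dots> \<noteq> 0" using assms(1) by (auto simp: power2_eq_1_iff)
    finally show "(fst (\<alpha> ^ 1, \<alpha> ^ (k - 1)) - fst (\<alpha> ^ 0, \<alpha> ^ (k - 0))) *
        (snd (\<alpha> ^ 2, \<alpha> ^ (k - 2)) - snd (\<alpha> ^ 0, \<alpha> ^ (k - 0))) \<noteq>
      (snd (\<alpha> ^ 1, \<alpha> ^ (k - 1)) - snd (\<alpha> ^ 0, \<alpha> ^ (k - 0))) *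
        (fst (\<alpha> ^ 2, \<alpha> ^ (k - 2)) - fst (\<alpha> ^ 0, \<alpha> ^ (k - 0)))"
      by (simp add: k)
  qed
  moreover have "card V = k + 1" unfolding V_def by (simp add: card_image[OF inj])
  ultimately show ?thesis by simp
qed

section \<open>The heptagon\<close>

lemma h_ge_7:
  assumes golden: "\<alpha> + 1 \<le> \<alpha>\<^sup>2" and "1 < \<alpha>" "\<alpha> < 2"
  shows "h \<alpha> \<ge> 7"
proof -
  obtain n where "1 / (2 - \<alpha>) < \<alpha> ^ n"
    using real_arch_pow[OF \<open>1 < \<alpha>\<close>] by blast
  define u where "u = \<alpha> ^ n"
  have u: "1 < (2 - \<alpha>) * u"
    using \<open>1 / (2 - \<alpha>) < \<alpha> ^ n\<close> \<open>\<alpha> < 2\<close> by (simp add: u_def field_simps)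
  \<comment> \<open>Since 2 - \<alpha> < 1, the choice of \<open>n\<close> forces
    \<open>n > 0\<close>.\<close>
  have "1 < u"
  proof -
    have "(2 - \<alpha>) * u \<le> 1 * u"
      using assms by (intro mult_right_mono) (auto simp: u_def)
    with u show ?thesis by simp
  qed
  define v w where "v = \<alpha> * u" and "w = \<alpha> * v"
  have uvw: "u < v" "v < w" "\<alpha> < v" "\<alpha> * v = w" "\<alpha> * u = v"
    using assms(2) \<open>1 < u\<close> by (simp_all add: v_def w_def)
  have w_eq: "w = \<alpha>\<^sup>2 * u" by (simp add: v_def w_def power2_eq_square)
  \<comment> \<open>This gives u - 1 < w - v: the edge from (v, u) to (w, 1) is flatter than the
    edge of slope -1 from (u, v) to (v, u).\<close>
  have w_ge: "v + u \<le> w"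
    using mult_right_mono[OF golden, of u] \<open>1 < u\<close> by (simp add: w_eq v_def algebra_simps)
  \<comment> \<open>Hence (v, v) lies strictly beyond the chord from (\<alpha>, w) to (w,
    \<alpha>).\<close>
  have w_less: "w + \<alpha> < 2 * v"
    using mult_strict_left_mono[OF u, of \<alpha>] assms(2)
    by (simp add: w_eq v_def algebra_simps power2_eq_square)
  define V where "V = {(1, w), (u, v), (v, u), (w, 1), (w, \<alpha>), (v, v), (\<alpha>, w)}"
  have swap: "prod.swap ` V = V" unfolding V_def by auto
  have pw: "u = \<alpha> ^ n" "v = \<alpha> ^ (n + 1)" "w = \<alpha> ^ (n + 2)"
    by (simp_all add: u_def v_def w_def)
  have main: "\<exists>a c. \<forall>z\<in>V - {(\<alpha> ^ i, \<alpha> ^ j)}. a * \<alpha> ^ i + c * \<alpha> ^ j < a * fst z + c * snd z"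
    if ji: "j \<le> i" for i j
  proof -
    consider "i > n + 2" | "i = n + 2" "j = 0" | "i = n + 2" "j = 1" | "i = n + 2" "j > 1"
      | "i = n + 1" "j = n + 1" | "i = n + 1" "j = n" | "i = n + 1" "j < n" | "i \<le> n"
      using ji by linarith
    then show ?thesis
    proof cases
      case 1
      then have "w < \<alpha> ^ i" unfolding pw using assms by (intro power_strict_increasing)
      then show ?thesis
        by (intro separatorI[where a = "-1" and c = 0]) (use uvw(1-3) \<open>1 < u\<close> assms in \<open>auto simp: V_def\<close>)
    next
      case 2
      then have "\<alpha> ^ i = w" "\<alpha> ^ j = 1" by (simp_all add: pw)
      then show ?thesis
        by (intro separatorI[where a = 0 and c = 1]) (use uvw(1-3) \<open>1 < u\<close> assms in \<open>auto simp: V_def\<close>)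
    next
      case 3
      then have "\<alpha> ^ i = w" "\<alpha> ^ j = \<alpha>" by (simp_all add: pw)
      \<comment> \<open>This compares (v, v) with (w, \<alpha>) under 2 * x + y; it follows from w
        >= v + u and v < 2 * u.\<close>
      moreover have "3 * v < 2 * w + \<alpha>"
        using w_ge u uvw assms by (simp add: algebra_simps)
      ultimately show ?thesis
        by (intro separatorI[where a = "-2" and c = "-1"])
          (use uvw(1-3) w_ge w_less \<open>1 < u\<close> assms in \<open>auto simp: V_def\<close>)
    next
      case 4
      then have iw: "\<alpha> ^ i = w" by (simp add: pw)
      define t where "t = \<alpha> ^ j"
      have t: "\<alpha> < t"
        using 4 assms power_strict_increasing[of 1 j \<alpha>] by (simp add: t_def)
      text \<open>The functional is constant on the edge from \<open>(v, v)\<close> to \<open>(w, \<alpha>)\<close>.\<close>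
      have "(w - v) * (w - \<alpha>) \<le> (v - \<alpha>) * (w - \<alpha>)"
        using w_less uvw by (intro mult_right_mono) auto
      moreover have "(v - \<alpha>) * 1 \<le> (v - \<alpha>) * \<alpha>" "(w - v) * 1 \<le> (w - v) * \<alpha>"
        "(v - \<alpha>) * u \<le> (v - \<alpha>) * v" "(w - v) * u \<le> (w - v) * v"
        using uvw assms by (auto intro!: mult_left_mono)
      ultimately have "\<forall>z\<in>V. (v - \<alpha>) * fst z + (w - v) * snd z \<le> (v - \<alpha>) * w + (w - v) * \<alpha>"
        by (simp add: V_def algebra_simps)
      moreover have "(w - v) * \<alpha> < (w - v) * t" using t uvw by simp
      ultimately show ?thesis
        unfolding iw t_def[symmetric]
        by (intro separatorI[where a = "-(v - \<alpha>)" and c = "-(w - v)"]) (fastforce simp: algebra_simps)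
    next
      case 5
      then have "\<alpha> ^ i = v" "\<alpha> ^ j = v" by (simp_all add: pw)
      then show ?thesis
        by (intro separatorI[where a = "-1" and c = "-1"])
          (use uvw(1-3) w_ge w_less \<open>1 < u\<close> assms in \<open>auto simp: V_def\<close>)
    next
      case 6
      then have ij: "\<alpha> ^ i = v" "\<alpha> ^ j = u" by (simp_all add: pw)
      text \<open>With \<open>d = w - v\<close> and \<open>e = u - 1\<close>, the edges at \<open>(v, u)\<close> have slopes \<open>-1\<close> and \<open>-e/d\<close>;
        the functional has the mean slope.\<close>
      define d e where "d = w - v" and "e = u - 1"
      have de: "e < d" "0 < e" using w_ge \<open>1 < u\<close> by (simp_all add: d_def e_def)
      have "(e + d) * (v - u) < (2 * d) * (v - u)" "(e + d) * (v - 1) < (2 * d) * (w - u)"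
        "(2 * d) * e < (e + d) * d"
        using de uvw(1-3) w_ge \<open>1 < u\<close> by (auto intro!: mult_strict_mono)
      moreover have "(2 * d) * 1 \<le> (2 * d) * \<alpha>" "(e + d) * 1 \<le> (e + d) * \<alpha>"
        "(2 * d) * u < (2 * d) * v"
        using de uvw(1-3) assms by (auto intro!: mult_left_mono)
      ultimately have "\<forall>z\<in>V - {(v, u)}. (e + d) * v + (2 * d) * u < (e + d) * fst z + (2 * d) * snd z"
        using e_def d_def by (auto simp: V_def algebra_simps)
      then show ?thesis unfolding ij by blast
    next
      case 7
      then have iv: "\<alpha> ^ i = v" by (simp add: pw)
      define t where "t = \<alpha> ^ j"
      have t: "t < u"
        using 7 assms power_strict_increasing[of j n \<alpha>] by (simp add: t_def u_def)
      text \<open>The functional is constant on the edge from \<open>(v, u)\<close> to \<open>(w, 1)\<close>.\<close>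
      have "(u - 1) * (v - u) \<le> (w - v) * (v - u)" "(u - 1) * (v - 1) \<le> (w - v) * (w - u)"
        using w_ge uvw(1-3) \<open>1 < u\<close> by (auto intro!: mult_mono)
      moreover have "(u - 1) * 1 \<le> (u - 1) * \<alpha>" "(w - v) * 1 \<le> (w - v) * \<alpha>"
        "(w - v) * u \<le> (w - v) * v"
        using uvw \<open>1 < u\<close> assms by (auto intro!: mult_left_mono)
      ultimately have "\<forall>z\<in>V. (u - 1) * v + (w - v) * u \<le> (u - 1) * fst z + (w - v) * snd z"
        by (simp add: V_def algebra_simps)
      moreover have "(w - v) * t < (w - v) * u" using t uvw by simp
      ultimately show ?thesis
        unfolding iv t_def[symmetric]
        by (intro separatorI[where a = "u - 1" and c = "w - v"]) fastforce
    next
      case 8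
      \<comment> \<open>Both coordinates are at most u, so their sum is below u + v, the least value
        of x + y on \<open>V\<close>.\<close>
      then have "\<alpha> ^ i \<le> u" "\<alpha> ^ j \<le> u"
        using ji assms by (auto simp: u_def intro!: power_increasing)
      then show ?thesis
        by (intro separatorI[where a = 1 and c = 1])
          (use uvw(1-3) w_ge w_less \<open>1 < u\<close> assms in \<open>auto simp: V_def\<close>)
    qed
  qed
  have "V \<subseteq> exp_lattice \<alpha>"
    using mem_exp_lattice[of \<alpha> 0 "n + 2"] mem_exp_lattice[of \<alpha> 1 "n + 2"]
      mem_exp_lattice[of \<alpha> n "n + 1"] mem_exp_lattice[of \<alpha> "n + 1" n]
      mem_exp_lattice[of \<alpha> "n + 1" "n + 1"] mem_exp_lattice[of \<alpha> "n + 2" 0]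
      mem_exp_lattice[of \<alpha> "n + 2" 1] by (simp add: V_def pw)
  then have "enat (card V) \<le> h \<alpha>"
  proof (rule h_ge[rotated])
    show "finite V" by (simp add: V_def)
    show "\<exists>a c. \<forall>v\<in>V - {(\<alpha> ^ i, \<alpha> ^ j)}. a * \<alpha> ^ i + c * \<alpha> ^ j < a * fst v + c * snd v" for i j
      using main[of j i] separator_swap[OF swap main[of i j]] by (cases "j \<le> i") auto
    show "(v, v) \<in> V" "(v, u) \<in> V" "(u, v) \<in> V" by (simp_all add: V_def)
    show "(fst (v, u) - fst (v, v)) * (snd (u, v) - snd (v, v)) \<noteq>
      (snd (v, u) - snd (v, v)) * (fst (u, v) - fst (v, v))"
      using uvw by simp
  qed
  moreover have "card V = 7" using uvw \<open>1 < u\<close> assms by (auto simp: V_def)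
  ultimately show ?thesis by (simp add: numeral_eq_enat)
qed

section \<open>The three ranges of \<alpha>\<close>

theorem theorem3:
  shows "(\<forall>\<alpha>::real. 2 \<le> \<alpha> \<longrightarrow> h \<alpha> \<ge> 5) \<and>
         (\<forall>\<alpha>::real. (1 + sqrt 5) / 2 \<le> \<alpha> \<and> \<alpha> < 2 \<longrightarrow> h \<alpha> \<ge> 7) \<and>
         (\<forall>\<alpha>::real. 1 < \<alpha> \<and> \<alpha> < (1 + sqrt 5) / 2 \<longrightarrow>
            h \<alpha> \<ge> enat (nat \<lfloor>sqrt (1 / (\<alpha> - 1))\<rfloor>))"
proof (intro conjI allI impI)
  fix \<alpha> :: real assume "2 \<le> \<alpha>"
  then show "h \<alpha> \<ge> 5" by (intro h_ge_5) simp
next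
  fix \<alpha> :: real assume \<alpha>: "(1 + sqrt 5) / 2 \<le> \<alpha> \<and> \<alpha> < 2"
  have "1 < (1 + sqrt 5) / 2" by simp
  with \<alpha> have "1 < \<alpha>" by (meson less_le_trans)
  \<comment> \<open>Squaring sqrt 5 <= 2 * \<alpha> - 1 turns the golden ratio bound into the
    quadratic inequality required by \<open>h_ge_7\<close>.\<close>
  moreover have "(sqrt 5)\<^sup>2 \<le> (2 * \<alpha> - 1)\<^sup>2"
    using \<alpha> by (intro power_mono) auto
  then have "\<alpha> + 1 \<le> \<alpha>\<^sup>2" by (simp add: power2_diff power_mult_distrib)
  ultimately show "h \<alpha> \<ge> 7" using \<alpha> by (intro h_ge_7) auto
next
  fix \<alpha> :: real assume "1 < \<alpha> \<and> \<alpha> < (1 + sqrt 5) / 2"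
  then have \<alpha>: "1 < \<alpha>" by simp
  define k where "k = nat \<lfloor>sqrt (1 / (\<alpha> - 1))\<rfloor>"
  show "h \<alpha> \<ge> enat (nat \<lfloor>sqrt (1 / (\<alpha> - 1))\<rfloor>)"
  \<comment> \<open>The pentagon exists for every \<alpha> > 1 and settles small
    \<open>k\<close>.\<close>
  proof (cases "k \<le> 5")
    case True
    then have "enat k \<le> 5" by (simp add: numeral_eq_enat)
    with h_ge_5[OF \<alpha>] show ?thesis unfolding k_def by (rule order_trans[rotated])
  next
    case False
    have "real k \<le> sqrt (1 / (\<alpha> - 1))" unfolding k_def using \<alpha> by simp
    then have "(real k)\<^sup>2 \<le> (sqrt (1 / (\<alpha> - 1)))\<^sup>2" by (intro power_mono) auto
    then have k2: "(real k)\<^sup>2 * (\<alpha> - 1) \<le> 1" using \<alpha> by (simp add: field_simps)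
    \<comment> \<open>The goal (1 + t)^2 < 4 * \<alpha> * t is equivalent to (t - 1)^2 < 4 *
      (\<alpha> - 1) * t. The geometric sum gives t - 1 <= (\<alpha> - 1) * k * t; squaring and
      \<open>k2\<close> bound the left side by (\<alpha> - 1) * t^2, and t <= exp 1 < 4
      finishes.\<close>
    define t where "t = \<alpha> ^ k"
    have "real k * (\<alpha> - 1) \<le> (real k)\<^sup>2 * (\<alpha> - 1)"
      using \<alpha> False by (intro mult_right_mono) (auto simp: power2_eq_square)
    then have "real k * (\<alpha> - 1) \<le> 1" using k2 by linarith
    have "t \<le> exp (\<alpha> - 1) ^ k"
      unfolding t_def using exp_ge_add_one_self[of "\<alpha> - 1"] \<alpha> by (intro power_mono) auto
    also have "\<dots> = exp (real k * (\<alpha> - 1))" by (simp add: exp_of_nat_mult)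
    also have "\<dots> \<le> exp 1" using \<open>real k * (\<alpha> - 1) \<le> 1\<close> by simp
    also have "\<dots> < 4" using exp_le by linarith
    finally have t4: "t < 4" .
    have t1: "1 \<le> t" unfolding t_def using \<alpha> by simp
    have "t - 1 = (\<alpha> - 1) * (\<Sum>i<k. \<alpha> ^ i)" unfolding t_def by (rule power_diff_1_eq)
    also have "\<dots> \<le> (\<alpha> - 1) * (\<Sum>i<k. t)"
      unfolding t_def using \<alpha> by (intro mult_left_mono sum_mono power_increasing) auto
    finally have "(t - 1)\<^sup>2 \<le> ((\<alpha> - 1) * (real k * t))\<^sup>2"
      using t1 by (intro power_mono) auto
    also have "\<dots> = (real k)\<^sup>2 * (\<alpha> - 1) * ((\<alpha> - 1) * t * t)"
      by (simp add: power2_eq_square algebra_simps)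
    also have "\<dots> \<le> 1 * ((\<alpha> - 1) * t * t)"
      using k2 \<alpha> t1 by (intro mult_right_mono) auto
    also have "\<dots> < (\<alpha> - 1) * t * 4"
      using \<alpha> t1 t4 by simp
    finally have "(1 + \<alpha> ^ k)\<^sup>2 < 4 * \<alpha> ^ (k + 1)"
      by (simp add: t_def power2_eq_square algebra_simps)
    then have "enat (k + 1) \<le> h \<alpha>" using \<alpha> False by (intro h_ge_hyperbola) auto
    moreover have "enat k \<le> enat (k + 1)" by simp
    ultimately show ?thesis unfolding k_def by (rule order_trans[rotated])
  qed
qed

end
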